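(* Let $a,b>0$. (1) For $(a,b)\in D_{1}$ and each $x\in(0,1)$, $$\frac{1}{3}\leq \frac{F\left(a,b;a+b;\left(\frac{1-x}{1+2x}\right)^3\right)}{(1+2x)F(a,b;a+b;1-x^3)}\leq \frac{\sqrt{3}B(a,b)}{6\pi}.$$ (2) For $(a,b)\in D_{3}$ and each $x\in(0,1)$, $$\frac{\sqrt{3}B(a,b)}{6\pi}\leq \frac{F\left(a,b;a+b;\left(\frac{1-x}{1+2x}\right)^3\right)}{(1+2x)F(a,b;a+b;1-x^3)}\leq \frac{1}{3}.$$ (3) For $(a,b)\in D_{5}$ and each $x\in(0,1)$, $$(1+2x)F(a,b;a+b;1-x^3)\leq 3F\left(a,b;a+b;\left(\frac{1-x}{1+2x}\right)^3\right)\leq (1+2x)\left[F(a,b;a+b;1-x^3)+\frac{2(R(a,b)-\log 27)}{B(a,b)}\right].$$ (4) For $(a,b)\in D_{6}$ and each $x\in(0,1)$, $$0\leq(1+2x)F(a,b;a+b;1-x^3)-3F\left(a,b;a+b;\left(\frac{1-x}{1+2x}\right)^3\right)\leq \frac{2(1+2x)(\log 27-R(a,b))}{B(a,b)}.$$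
   Context: For real $a,b,c$ with $c\neq 0,-1,-2,\dots$ and $x\in(-1,1)$, the Gaussian hypergeometric function is $F(a,b;c;x)=\sum_{n=0}^{\infty}\frac{(a,n)(b,n)}{(c,n)}\frac{x^n}{n!}$, where $(a,n)=a(a+1)\cdots(a+n-1)$ for $n\ge 1$ and $(a,0)=1$. $B(a,b)=\Gamma(a)\Gamma(b)/\Gamma(a+b)$ is the beta function, and $R(a,b)=-\Psi(a)-\Psi(b)-2\gamma$, where $\Psi=\Gamma'/\Gamma$ is the digamma function and $\gamma$ is the Euler-Mascheroni constant. Regions in $\{(a,b)\in\mathbb{R}^2 : a>0,\ b>0\}$: $D_{1}=\{(a,b) : a,b>0,\ ab\leq 2/9,\ ab-\frac{2}{9}(a+b)\leq 0\}$; $D_{3}=\{(a,b) : a,b>0,\ ab\geq 2/9,\ ab-\frac{2}{9}(a+b)\geq 0\}$; $D_{5}=\{(a,b) : a,b>0,\ a+b\leq 1,\ ab-\frac{2}{9}(a+b)\leq 0\}$; $D_{6}=\{(a,b) : a,b>0,\ a+b\geq 1,\ ab-\frac{2}{9}(a+b)\geq 0\}$. *)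

theory Defs
  imports "HOL-Analysis.Analysis" "HOL-Real_Asymp.Real_Asymp"
begin

text \<open>Intended for \<open>-1 < x < 1\<close> and \<open>c\<close> not one of 0, -1, -2, ...: for \<open>\<bar>x\<bar> \<ge> 1\<close> the series
  may diverge, and for excluded \<open>c\<close> it contains divisions by zero.\<close>

definition gauss_F :: "real \<Rightarrow> real \<Rightarrow> real \<Rightarrow> real \<Rightarrow> real" where
  "gauss_F a b c x =
     (\<Sum>n. pochhammer a n * pochhammer b n / pochhammer c n * (x ^ n / fact n))"

lemma gauss_F_eval_fps: "gauss_F a b c x = eval_fps (fps_hypergeo [a, b] [c] 1) x"
  by (simp add: gauss_F_def eval_fps_def fps_hypergeo_nth_alt mult_ac)

lemma gauss_F_sums:
  assumes "\<bar>x\<bar> < 1"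
  shows "(\<lambda>n. pochhammer a n * pochhammer b n / pochhammer c n * (x ^ n / fact n)) sums gauss_F a b c x"
proof -
  define f where "f = (\<lambda>n. pochhammer a n * pochhammer b n / pochhammer c n * (x ^ n / fact n))"
  define q where "q = (\<lambda>n. (a + real n) * (b + real n) / ((c + real n) * (real n + 1)) * x)"
  have step: "f (Suc n) = q n * f n" for n
    by (simp add: f_def q_def pochhammer_Suc mult_ac add.commute)
  have "(\<lambda>n. (a + real n) * (b + real n) / ((c + real n) * (real n + 1))) \<longlonglongrightarrow> 1"
    by real_asymp
  from tendsto_mult_right[OF this, of x] have "(\<lambda>n. \<bar>q n\<bar>) \<longlonglongrightarrow> \<bar>x\<bar>"
    unfolding q_def by (intro tendsto_rabs) simp
  moreover obtain r where r: "\<bar>x\<bar> < r" "r < 1"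
    using assms dense by blast
  ultimately have "eventually (\<lambda>n. \<bar>q n\<bar> < r) sequentially"
    by (simp add: order_tendsto_iff)
  then obtain N where N: "\<bar>q n\<bar> < r" if "n \<ge> N" for n
    unfolding eventually_sequentially by blast
  have "summable f"
  proof (rule summable_ratio_test)
    show "r < 1" by fact
    show "norm (f (Suc n)) \<le> r * norm (f n)" if "n \<ge> N" for n
      using N[OF that] by (simp add: step abs_mult mult_right_mono)
  qed
  then show ?thesis
    unfolding gauss_F_def f_def by (rule summable_sums)
qed

definition ramanujan_R :: "real \<Rightarrow> real \<Rightarrow> real" where
  "ramanujan_R a b = - Digamma a - Digamma b - 2 * euler_mascheroni"

definition region_D1 :: "(real \<times> real) set" where
  "region_D1 = {(a, b). a > 0 \<and> b > 0 \<and> a * b \<le> 2 / 9 \<and> a * b - 2 / 9 * (a + b) \<le> 0}"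

definition region_D3 :: "(real \<times> real) set" where
  "region_D3 = {(a, b). a > 0 \<and> b > 0 \<and> a * b \<ge> 2 / 9 \<and> a * b - 2 / 9 * (a + b) \<ge> 0}"

definition region_D5 :: "(real \<times> real) set" where
  "region_D5 = {(a, b). a > 0 \<and> b > 0 \<and> a + b \<le> 1 \<and> a * b - 2 / 9 * (a + b) \<le> 0}"

definition region_D6 :: "(real \<times> real) set" where
  "region_D6 = {(a, b). a > 0 \<and> b > 0 \<and> a + b \<ge> 1 \<and> a * b - 2 / 9 * (a + b) \<ge> 0}"

end

theory Submission
  imports Defs
begin

text \<open>Write \<open>F\<close> for \<open>F(a,b;a+b;\<cdot>)\<close>, \<open>F\<^sub>0\<close> for \<open>F(1/3,2/3;1;\<cdot>)\<close>, and
  \<open>B\<close>, \<open>B\<^sub>0\<close> for the beta values \<open>B(a,b)\<close> and \<open>B(1/3,2/3) = 2\<pi>/\<surd>3\<close>. Put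
  \<open>y = ((1-x)/(1+2x))\<^sup>3\<close> and \<open>z = 1-x\<^sup>3\<close>, so that \<open>0 < y \<le> z < 1\<close>.

  For \<open>F\<^sub>0\<close> all the inequalities are equalities: the cubic transformation says
  \<open>3 F\<^sub>0(y) = (1+2x) F\<^sub>0(z)\<close> (lemma \<open>gauss_F_cubic_complementary\<close>). Both sides of the
  transformation are solutions of one second-order linear equation that is singular at \<open>0\<close>, and the
  solution that is regular there is unique up to a factor, because the Wronskian, weighted by the
  leading coefficient, is constant and vanishes at \<open>0\<close>.

  The general case is a comparison of \<open>F\<close> with \<open>F\<^sub>0\<close>. The quotient of their \<open>n\<close>-th coefficients
  is monotone in \<open>n\<close>, decreasing for \<open>D\<^sub>1\<close> and increasing for \<open>D\<^sub>3\<close>; it starts at \<open>1\<close> and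
  tends to \<open>B\<^sub>0/B\<close>, since the \<open>n\<close>-th coefficient of \<open>F\<close> is asymptotic to \<open>1/(B n)\<close>. Take
  \<open>D\<^sub>1\<close>. Monotone coefficient quotients make \<open>F/F\<^sub>0\<close> monotone
  (lemma \<open>power_series_ratio_antimono\<close>), so \<open>F(y)/F\<^sub>0(y) \<ge> F(z)/F\<^sub>0(z)\<close>, which is the bound by
  \<open>1/3\<close>. The two extreme values of the coefficient quotient give \<open>F \<le> F\<^sub>0\<close> and
  \<open>B\<^sub>0 F\<^sub>0 \<le> B F\<close>, which together are the bound by \<open>\<surd>3 B/(6\<pi>) = B/(3 B\<^sub>0)\<close>.

  For the differences, \<open>K = B F - B\<^sub>0 F\<^sub>0\<close> has nonnegative coefficients, hence increases from a
  nonnegative value, and stays below the sum of its coefficients. That sum is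
  \<open>R(a,b) - R(1/3,2/3) = R(a,b) - log 27\<close>: the logarithmic singularities of \<open>B F\<close> and
  \<open>B\<^sub>0 F\<^sub>0\<close> at \<open>1\<close> cancel, and \<open>R\<close> is the constant term next to the singularity
  (lemma \<open>beta_coeff_sums\<close>). Since \<open>D\<^sub>5 \<subseteq> D\<^sub>1\<close> and \<open>D\<^sub>6 \<subseteq> D\<^sub>3\<close>, the same comparison serves
  all four parts; \<open>D\<^sub>3\<close> and \<open>D\<^sub>6\<close> are obtained by exchanging the two parameter pairs.\<close>

section \<open>Zero-balanced coefficients\<close>

definition zb_coeff :: "real \<Rightarrow> real \<Rightarrow> nat \<Rightarrow> real" where
  "zb_coeff a b n = pochhammer a n * pochhammer b n / (pochhammer (a + b) n * fact n)"

lemma gauss_F_zb_sums: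
  assumes "\<bar>x\<bar> < 1"
  shows "(\<lambda>n. zb_coeff a b n * x ^ n) sums gauss_F a b (a + b) x"
  using gauss_F_sums[OF assms, of a b "a + b"] by (simp add: zb_coeff_def field_simps)

lemma zb_coeff_0 [simp]: "zb_coeff a b 0 = 1"
  by (simp add: zb_coeff_def)

lemma zb_coeff_Suc:
  "zb_coeff a b (Suc n) =
     (a + real n) * (b + real n) / ((a + b + real n) * (1 + real n)) * zb_coeff a b n"
  by (simp add: zb_coeff_def pochhammer_Suc mult_ac)

lemma zb_coeff_pos: "a > 0 \<Longrightarrow> b > 0 \<Longrightarrow> zb_coeff a b n > 0"
  by (simp add: zb_coeff_def pochhammer_pos)

lemma Beta_pos: "a > 0 \<Longrightarrow> b > 0 \<Longrightarrow> Beta a b > (0::real)"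
  by (simp add: Beta_def)

text \<open>Multiplication by the beta value removes the parameters from the leading behaviour: these
  coefficients, \<open>\<Gamma>(a+n)\<Gamma>(b+n)/(\<Gamma>(a+b+n) n!)\<close>, are asymptotic to \<open>1/n\<close> for every \<open>a\<close> and \<open>b\<close>,
  so that those of two different pairs can be subtracted and summed.\<close>

definition beta_coeff :: "real \<Rightarrow> real \<Rightarrow> nat \<Rightarrow> real" where
  "beta_coeff a b n = Beta a b * zb_coeff a b n"

lemma beta_coeff_0: "beta_coeff a b 0 = Beta a b"
  by (simp add: beta_coeff_def)

lemma beta_coeff_Suc:
  "beta_coeff a b (Suc n) =
     (a + real n) * (b + real n) / ((a + b + real n) * (1 + real n)) * beta_coeff a b n"
  by (simp add: beta_coeff_def zb_coeff_Suc)

lemma beta_coeff_pos: "a > 0 \<Longrightarrow> b > 0 \<Longrightarrow> beta_coeff a b n > 0"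
  by (simp add: beta_coeff_def Beta_pos zb_coeff_pos)

text \<open>In Euler's product \<open>1/\<Gamma>(a) = lim (a)\<^sub>n\<^sub>+\<^sub>1 / (n! n\<^sup>a)\<close>, the powers of \<open>n\<close> for the parameters
  \<open>a\<close>, \<open>b\<close> and \<open>a + b\<close> cancel; this is what zero-balanced means.\<close>

lemma beta_coeff_asymp:
  assumes "a > 0" "b > 0"
  shows "(\<lambda>n. real n * beta_coeff a b n) \<longlonglongrightarrow> 1"
proof -
  have "(\<lambda>n. rGamma_series a n * rGamma_series b n / rGamma_series (a + b) n)
          \<longlonglongrightarrow> rGamma a * rGamma b / rGamma (a + b)"
    using assms by (intro tendsto_intros) (auto simp: rGamma_eq_zero_iff)
  also have "rGamma a * rGamma b / rGamma (a + b) = inverse (Beta a b)"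
    by (simp add: Beta_altdef Gamma_def field_simps)
  finally have "(\<lambda>n. Beta a b * (rGamma_series a n * rGamma_series b n / rGamma_series (a + b) n))
          \<longlonglongrightarrow> Beta a b * inverse (Beta a b)"
    by (intro tendsto_intros)
  moreover have "Beta a b * (rGamma_series a n * rGamma_series b n / rGamma_series (a + b) n)
          = real (Suc n) * beta_coeff a b (Suc n)" for n
    by (simp add: rGamma_series_def beta_coeff_def zb_coeff_def ring_distribs exp_add
          del: of_nat_Suc)
  ultimately have "(\<lambda>n. real (Suc n) * beta_coeff a b (Suc n)) \<longlonglongrightarrow> 1"
    using Beta_pos[OF assms] by simp
  then show ?thesis
    by (subst (asm) filterlim_sequentially_Suc)
qed

section \<open>Comparison of two zero-balanced series\<close>

text \<open>For pairs of positive parameters this is the condition that the coefficient recurrence multiplies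
  by a factor that is, at every index, at most as large for \<open>(a,b)\<close> as for \<open>(a',b')\<close>. With
  \<open>(1/3,2/3)\<close> on the right it is the condition that defines \<open>D\<^sub>1\<close>, on the left the one for \<open>D\<^sub>3\<close>.\<close>

definition zb_le :: "real \<Rightarrow> real \<Rightarrow> real \<Rightarrow> real \<Rightarrow> bool" where
  "zb_le a b a' b' \<longleftrightarrow> a * b \<le> a' * b' \<and> a * b * (a' + b') \<le> a' * b' * (a + b)"

text \<open>The terms of degree 2 and 3 in \<open>n\<close> agree on both sides, and the two parts of the order are the
  inequalities between the remaining coefficients.\<close>

lemma zb_le_cross_mult:
  assumes "zb_le a b a' b'"
  shows "(a + real n) * (b + real n) * (a' + b' + real n)
           \<le> (a' + real n) * (b' + real n) * (a + b + real n)"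
proof -
  have "(a' + real n) * (b' + real n) * (a + b + real n)
          - (a + real n) * (b + real n) * (a' + b' + real n)
        = real n * (a' * b' - a * b) + (a' * b' * (a + b) - a * b * (a' + b'))"
    by (simp add: algebra_simps)
  also have "\<dots> \<ge> 0"
    using assms by (simp add: zb_le_def)
  finally show ?thesis by simp
qed

lemma decseq_zb_coeff_ratio:
  assumes "a > 0" "b > 0" "a' > 0" "b' > 0" "zb_le a b a' b'"
  shows "decseq (\<lambda>n. zb_coeff a b n / zb_coeff a' b' n)"
proof (rule decseq_SucI)
  fix n
  define s where "s = (a + real n) * (b + real n) / (a + b + real n)"
  define s' where "s' = (a' + real n) * (b' + real n) / (a' + b' + real n)"
  have "s \<le> s'"
    using zb_le_cross_mult[OF assms(5), of n] assms
    by (simp add: s_def s'_def divide_simps add_pos_nonneg mult_ac split: if_splits)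
  have "s' > 0"
    unfolding s'_def using assms by (intro divide_pos_pos mult_pos_pos add_pos_nonneg) auto
  have "zb_coeff a b (Suc n) / zb_coeff a' b' (Suc n)
          = (s / (1 + real n)) / (s' / (1 + real n)) * (zb_coeff a b n / zb_coeff a' b' n)"
    by (simp add: zb_coeff_Suc s_def s'_def mult_ac)
  also have "\<dots> = s / s' * (zb_coeff a b n / zb_coeff a' b' n)"
    by (simp add: add_eq_0_iff)
  also have "\<dots> \<le> 1 * (zb_coeff a b n / zb_coeff a' b' n)"
    using \<open>s \<le> s'\<close> \<open>s' > 0\<close> zb_coeff_pos assms
    by (intro mult_right_mono) (auto intro!: divide_nonneg_nonneg less_imp_le)
  finally show "zb_coeff a b (Suc n) / zb_coeff a' b' (Suc n)
                  \<le> zb_coeff a b n / zb_coeff a' b' n" by simp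
qed

lemma zb_coeff_le:
  assumes "a > 0" "b > 0" "a' > 0" "b' > 0" "zb_le a b a' b'"
  shows "zb_coeff a b n \<le> zb_coeff a' b' n"
  using decseqD[OF decseq_zb_coeff_ratio[OF assms], of 0 n] zb_coeff_pos[of a' b' n] assms
  by (simp add: divide_le_eq_1)

text \<open>The weighted coefficients are ordered the other way round, because their quotient decreases to the
  limit \<open>1\<close> instead of starting from it.\<close>

lemma beta_coeff_ge:
  assumes "a > 0" "b > 0" "a' > 0" "b' > 0" "zb_le a b a' b'"
  shows "beta_coeff a' b' n \<le> beta_coeff a b n"
proof -
  have eq: "beta_coeff a b n / beta_coeff a' b' n
          = Beta a b / Beta a' b' * (zb_coeff a b n / zb_coeff a' b' n)" for n
    by (simp add: beta_coeff_def)
  have dec: "decseq (\<lambda>n. beta_coeff a b n / beta_coeff a' b' n)"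
    unfolding eq decseq_def
    using decseqD[OF decseq_zb_coeff_ratio[OF assms]] Beta_pos[of a b] Beta_pos[of a' b'] assms
    by (intro allI impI mult_left_mono) auto
  have "(\<lambda>n. (real n * beta_coeff a b n) / (real n * beta_coeff a' b' n)) \<longlonglongrightarrow> 1 / 1"
    using assms by (intro tendsto_divide beta_coeff_asymp) auto
  then have "(\<lambda>n. beta_coeff a b n / beta_coeff a' b' n) \<longlonglongrightarrow> 1 / 1"
  proof (rule Lim_transform_eventually)
    show "eventually (\<lambda>n. real n * beta_coeff a b n / (real n * beta_coeff a' b' n)
            = beta_coeff a b n / beta_coeff a' b' n) sequentially"
      using eventually_gt_at_top[of 0] by eventually_elim simp
  qed
  then have "(\<lambda>n. beta_coeff a b n / beta_coeff a' b' n) \<longlonglongrightarrow> 1" by simp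
  from decseq_ge[OF dec this, of n] show ?thesis
    using beta_coeff_pos[of a' b' n] assms by (simp add: le_divide_eq_1)
qed

text \<open>Let \<open>r\<close> be the quotient of the two sums at \<open>z\<close>. The terms of \<open>\<Sum> (A\<^sub>n - r C\<^sub>n) z\<^sup>n = 0\<close> change
  sign at most once, from nonnegative to nonpositive. Passing from \<open>z\<close> to \<open>y\<close> multiplies them by the
  decreasing weights \<open>(y/z)\<^sup>n\<close>, which favours the nonnegative ones, so the sum at \<open>y\<close> is
  nonnegative.\<close>

lemma power_series_ratio_antimono:
  fixes A C :: "nat \<Rightarrow> real"
  assumes pos: "\<And>n. C n > 0" and dec: "decseq (\<lambda>n. A n / C n)"
    and yz: "0 < y" "y \<le> z"
    and Ay: "(\<lambda>n. A n * y ^ n) sums Ay" and Az: "(\<lambda>n. A n * z ^ n) sums Az"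
    and Cy: "(\<lambda>n. C n * y ^ n) sums Cy" and Cz: "(\<lambda>n. C n * z ^ n) sums Cz"
    and Cz_pos: "Cz > 0"
  shows "Az * Cy \<le> Ay * Cz"
proof -
  define r where "r = Az / Cz"
  define d where "d n = A n - r * C n" for n
  have dy: "(\<lambda>n. d n * y ^ n) sums (Ay - r * Cy)"
    using sums_diff[OF Ay sums_mult[OF Cy, of r]] by (simp add: d_def algebra_simps)
  have dz: "(\<lambda>n. d n * z ^ n) sums 0"
    using sums_diff[OF Az sums_mult[OF Cz, of r]] Cz_pos by (simp add: d_def r_def algebra_simps)
  have sgn: "d n < 0 \<longleftrightarrow> A n / C n < r" for n
    using pos[of n] by (simp add: d_def divide_less_eq)
  have "0 \<le> Ay - r * Cy"
  proof (cases "\<exists>n. d n < 0")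
    case False
    then show ?thesis
      using yz by (intro sums_le[OF _ sums_zero dy]) (simp add: not_less)
  next
    case True
    define N where "N = (LEAST n. d n < 0)"
    have N: "d N < 0"
      unfolding N_def using True by (rule LeastI_ex)
    have before: "d n \<ge> 0" if "n < N" for n
      using not_less_Least[of n "\<lambda>n. d n < 0"] that by (simp add: N_def)
    have after: "d n \<le> 0" if "n \<ge> N" for n
      using N decseqD[OF dec that] by (auto simp: sgn intro!: less_imp_le)
    define q where "q = y / z"
    have q: "0 \<le> q" "q \<le> 1" and yq: "y = q * z"
      using yz by (auto simp: q_def)
    \<comment> \<open>Both factors of \<open>d n * (q ^ n - q ^ N)\<close> change sign at \<open>N\<close>.\<close>
    have "q ^ N * (d n * z ^ n) \<le> d n * y ^ n" for n
    proof -
      have "0 \<le> d n * (q ^ n - q ^ N)"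
      proof (cases "n < N")
        case True
        then show ?thesis
          using before[OF True] q by (intro mult_nonneg_nonneg) (auto intro!: power_decreasing)
      next
        case False
        then show ?thesis
          using after[of n] q by (intro mult_nonpos_nonpos) (auto intro!: power_decreasing)
      qed
      then have "0 \<le> d n * (q ^ n - q ^ N) * z ^ n"
        using yz by simp
      then show ?thesis by (simp add: yq power_mult_distrib algebra_simps)
    qed
    from sums_le[OF this sums_mult[OF dz, of "q ^ N"] dy] show ?thesis by simp
  qed
  then show ?thesis
    using Cz_pos by (simp add: r_def field_simps)
qed

lemma gauss_F_zb_pos:
  assumes "a > 0" "b > 0" "0 \<le> x" "x < 1"
  shows "gauss_F a b (a + b) x > 0"
proof -
  have s: "(\<lambda>n. zb_coeff a b n * x ^ n) sums gauss_F a b (a + b) x"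
    using assms by (intro gauss_F_zb_sums) auto
  have "(\<Sum>n<1. zb_coeff a b n * x ^ n) \<le> gauss_F a b (a + b) x"
    unfolding sums_unique[OF s] using assms zb_coeff_pos[of a b, THEN less_imp_le]
    by (intro sum_le_suminf sums_summable[OF s]) auto
  then show ?thesis by simp
qed

lemma gauss_F_zb_ratio_antimono:
  assumes "a > 0" "b > 0" "a' > 0" "b' > 0" "zb_le a b a' b'" "0 < y" "y \<le> z" "z < 1"
  shows "gauss_F a b (a + b) z * gauss_F a' b' (a' + b') y
           \<le> gauss_F a b (a + b) y * gauss_F a' b' (a' + b') z"
  by (rule power_series_ratio_antimono[OF zb_coeff_pos decseq_zb_coeff_ratio])
     (use assms in \<open>auto intro!: gauss_F_zb_sums gauss_F_zb_pos\<close>)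

lemma gauss_F_zb_le:
  assumes "a > 0" "b > 0" "a' > 0" "b' > 0" "zb_le a b a' b'" "0 \<le> y" "y < 1"
  shows "gauss_F a b (a + b) y \<le> gauss_F a' b' (a' + b') y"
  by (rule sums_le[OF _ gauss_F_zb_sums gauss_F_zb_sums])
     (use assms in \<open>auto intro!: mult_right_mono zb_coeff_le\<close>)

lemma beta_gauss_F_sums:
  assumes "\<bar>x\<bar> < 1"
  shows "(\<lambda>n. beta_coeff a b n * x ^ n) sums (Beta a b * gauss_F a b (a + b) x)"
  using sums_mult[OF gauss_F_zb_sums[OF assms], of "Beta a b"] by (simp add: beta_coeff_def mult_ac)

lemma beta_gauss_F_ge:
  assumes "a > 0" "b > 0" "a' > 0" "b' > 0" "zb_le a b a' b'" "0 \<le> y" "y < 1"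
  shows "Beta a' b' * gauss_F a' b' (a' + b') y \<le> Beta a b * gauss_F a b (a + b) y"
  by (rule sums_le[OF _ beta_gauss_F_sums beta_gauss_F_sums])
     (use assms in \<open>auto intro!: mult_right_mono beta_coeff_ge\<close>)

section \<open>Ramanujan's constant as a series\<close>

lemma beta_coeff_plus1:
  assumes "a > 0" "b > 0"
  shows "beta_coeff (a + 1) b n = (a + real n) / (a + b + real n) * beta_coeff a b n"
proof (induction n)
  case 0
  have "a \<notin> \<int>\<^sub>\<le>\<^sub>0" using assms by auto
  from Beta_plus1_left[OF this, of b] show ?case
    using assms by (simp add: beta_coeff_0 field_simps)
next
  case (Suc n)
  have nz: "a + b + real n \<noteq> 0" "a + b + real n + 1 \<noteq> 0" "1 + real n \<noteq> 0"
    using assms by linarith+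
  have eqs: "a + 1 + b + real n = a + b + real n + 1" "a + b + real (Suc n) = a + b + real n + 1"
       "a + 1 + real n = a + real (Suc n)"
    by auto
  show ?case
    using nz unfolding beta_coeff_Suc Suc.IH eqs by (simp add: mult_ac)
qed

text \<open>The differences telescope: up to the factor \<open>1/a\<close> they are the increments of
  \<open>n \<cdot> beta_coeff a b n\<close>, which runs from \<open>0\<close> to \<open>1\<close>. This is the shift \<open>a \<mapsto> a + 1\<close> that matches
  the functional equation \<open>\<Psi>(a+1) = \<Psi>(a) + 1/a\<close>.\<close>

lemma beta_coeff_step_sums:
  assumes "a > 0" "b > 0"
  shows "(\<lambda>n. beta_coeff a b n - beta_coeff (a + 1) b n) sums (1 / a)"
proof -
  have "(\<lambda>n. real (Suc n) * beta_coeff a b (Suc n) - real n * beta_coeff a b n) sums (1 - 0)"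
    using telescope_sums[OF beta_coeff_asymp[OF assms]] by simp
  from sums_mult[OF this, of "1 / a"]
  have "(\<lambda>n. 1 / a * (real (Suc n) * beta_coeff a b (Suc n) - real n * beta_coeff a b n)) sums (1 / a)"
    by simp
  moreover have "1 / a * (real (Suc n) * beta_coeff a b (Suc n) - real n * beta_coeff a b n)
      = beta_coeff a b n - beta_coeff (a + 1) b n" for n
  proof -
    have nz: "a + b + real n > 0" "1 + real n > 0" "a > 0"
      using assms by linarith+
    have "real (Suc n) * beta_coeff a b (Suc n)
            = (a + real n) * (b + real n) / (a + b + real n) * beta_coeff a b n"
      using nz by (simp add: beta_coeff_Suc)
    then have "1 / a * (real (Suc n) * beta_coeff a b (Suc n) - real n * beta_coeff a b n)
        = 1 / a * ((a + real n) * (b + real n) / (a + b + real n) - real n) * beta_coeff a b n"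
      by (simp add: algebra_simps)
    also have "1 / a * ((a + real n) * (b + real n) / (a + b + real n) - real n)
        = 1 - (a + real n) / (a + b + real n)"
      using nz by (simp add: divide_simps) (simp add: algebra_simps)
    finally show ?thesis
      by (simp only: beta_coeff_plus1[OF assms] left_diff_distrib mult_1_left)
  qed
  ultimately show ?thesis by simp
qed

lemma ramanujan_R_plus1:
  assumes "a > 0"
  shows "ramanujan_R (a + 1) b = ramanujan_R a b - 1 / a"
  using assms by (simp add: ramanujan_R_def Digamma_plus1)

lemma ramanujan_R_antimono:
  assumes "0 < a" "a \<le> a'"
  shows "ramanujan_R a' b \<le> ramanujan_R a b"
  using Digamma_real_mono[OF assms] by (simp add: ramanujan_R_def)

lemma beta_coeff_antimono:
  assumes "0 < a" "a \<le> a'" "b > 0"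
  shows "beta_coeff a' b n \<le> beta_coeff a b n"
proof (rule beta_coeff_ge)
  have "a * b * b \<le> a' * b * b" "a * b \<le> a' * b"
    using assms by (auto intro!: mult_right_mono)
  then show "zb_le a b a' b"
    by (simp add: zb_le_def algebra_simps)
qed (use assms in auto)


lemma beta_coeff_1: "b > 0 \<Longrightarrow> beta_coeff 1 b n = 1 / (b + real n)"
proof (induction n)
  case 0
  then show ?case by (simp add: beta_coeff_0 Beta_def add.commute[of 1] Gamma_plus1 nonpos_Ints_def Gamma_real_pos[THEN less_imp_neq, symmetric])
next
  case (Suc n)
  then show ?case by (simp add: beta_coeff_Suc add_ac)
qed

text \<open>At \<open>a = 1\<close> the series is the defining series of the digamma function; the shift by one reaches
  the other positive integers.\<close>

lemma beta_coeff_sums_of_nat: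
  assumes "b > 0"
  shows "(\<lambda>n. beta_coeff (real (Suc m)) b n - 1 / (1 + real n)) sums ramanujan_R (real (Suc m)) b"
proof (induction m)
  case 0
  have "(\<lambda>n. inverse (real (n + 1)) - inverse (b + real n)) sums (Digamma b + euler_mascheroni)"
    using summable_sums[OF summable_Digamma[of b]] assms by (simp add: Digamma_def)
  from sums_minus[OF this] show ?case
    using assms by (simp add: beta_coeff_1 ramanujan_R_def inverse_eq_divide add_ac)
next
  case (Suc m)
  have "real (Suc m) > 0" and eq: "real (Suc (Suc m)) = real (Suc m) + 1" by simp_all
  from sums_diff[OF Suc.IH beta_coeff_step_sums[OF this(1) assms]] ramanujan_R_plus1[OF this(1), of b]
  show ?case unfolding eq by (simp only: diff_diff_eq2) (simp add: algebra_simps)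
qed

lemma beta_coeff_diff_sums:
  assumes "a > 0" "b > 0"
  shows "(\<lambda>n. beta_coeff a b n - beta_coeff (a + real N) b n)
           sums (ramanujan_R a b - ramanujan_R (a + real N) b)"
proof (induction N)
  case (Suc N)
  have pos: "a + real N > 0" and eq: "a + real (Suc N) = (a + real N) + 1"
    using assms by simp_all
  show ?case
    using sums_add[OF Suc.IH beta_coeff_step_sums[OF pos assms(2)]]
    unfolding eq ramanujan_R_plus1[OF pos] by (simp add: diff_add_eq diff_diff_eq2)
qed simp

text \<open>The shift by one moves \<open>a\<close> to \<open>a' = a + N + 1\<close> without changing the error. There, series and
  constant are both decreasing in the first parameter and agree at the integers \<open>m + 1\<close> and \<open>m + 2\<close>
  on either side of \<open>a'\<close>, so they differ by at most the step \<open>1/(m + 1)\<close> of the constant.\<close>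

lemma beta_coeff_sums_approx:
  assumes "a > 0" "b > 0"
  shows "\<exists>s. (\<lambda>n. beta_coeff a b n - 1 / (1 + real n)) sums s
           \<and> \<bar>s - ramanujan_R a b\<bar> \<le> 1 / (1 + real N)"
proof -
  \<comment> \<open>One extra step beyond \<open>N\<close> makes \<open>a' > 1\<close>, so that the integer below \<open>a'\<close> is positive.\<close>
  define a' where "a' = a + real (Suc N)"
  define m where "m = nat \<lfloor>a'\<rfloor> - 1"
  have a'1: "a' \<ge> 1 + real N" "a' \<ge> 1"
    using assms by (auto simp: a'_def)
  then have "\<lfloor>a'\<rfloor> \<ge> 1" "\<lfloor>a'\<rfloor> \<ge> 1 + int N"
    by linarith+
  then have m': "real (Suc m) = of_int \<lfloor>a'\<rfloor>" and mN: "m \<ge> N"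
    by (auto simp: m_def)
  have m: "real (Suc m) \<le> a'" "a' \<le> real (Suc (Suc m))"
    using m' by linarith+
  note lo = beta_coeff_sums_of_nat[OF assms(2), of "Suc m"]
  note hi = beta_coeff_sums_of_nat[OF assms(2), of m]
  define u where "u n = beta_coeff a' b n - beta_coeff (real (Suc (Suc m))) b n" for n
  have u0: "u n \<ge> 0" for n
    unfolding u_def using beta_coeff_antimono[of a' "real (Suc (Suc m))" b n] a'1 m assms by simp
  have u1: "u n \<le> beta_coeff (real (Suc m)) b n - beta_coeff (real (Suc (Suc m))) b n" for n
    unfolding u_def using beta_coeff_antimono[of "real (Suc m)" a' b n] m assms by simp
  have "summable u"
  proof (rule summable_comparison_test')
    show "summable (\<lambda>n. beta_coeff (real (Suc m)) b n - beta_coeff (real (Suc (Suc m))) b n)"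
      using sums_summable[OF sums_diff[OF hi lo]] by simp
    show "norm (u n) \<le> beta_coeff (real (Suc m)) b n - beta_coeff (real (Suc (Suc m))) b n" for n
      using u0[of n] u1[of n] by simp
  qed
  then obtain t where "u sums t" by (auto simp: summable_def)
  from sums_add[OF this lo]
  have s': "(\<lambda>n. beta_coeff a' b n - 1 / (1 + real n)) sums (t + ramanujan_R (real (Suc (Suc m))) b)"
    (is "_ sums ?s'") by (simp add: u_def)
  have le: "ramanujan_R (real (Suc (Suc m))) b \<le> ?s'" "?s' \<le> ramanujan_R (real (Suc m)) b"
    using sums_le[OF _ lo s'] sums_le[OF _ s' hi] u0 u1 by (auto simp: u_def)
  have le': "ramanujan_R (real (Suc (Suc m))) b \<le> ramanujan_R a' b"
            "ramanujan_R a' b \<le> ramanujan_R (real (Suc m)) b"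
    using m a'1 by (auto intro!: ramanujan_R_antimono)
  have "ramanujan_R (real (Suc (Suc m))) b = ramanujan_R (real (Suc m)) b - 1 / (1 + real m)"
    using ramanujan_R_plus1[of "real (Suc m)" b] by (simp add: add_ac)
  moreover have "1 / (1 + real m) \<le> 1 / (1 + real N)"
    using mN by (simp add: frac_le)
  ultimately have close: "\<bar>?s' - ramanujan_R a' b\<bar> \<le> 1 / (1 + real N)"
    using le le' by linarith
  have "(\<lambda>n. beta_coeff a b n - 1 / (1 + real n)) sums
          (?s' + (ramanujan_R a b - ramanujan_R a' b))"
    using sums_add[OF s' beta_coeff_diff_sums[OF assms, of "Suc N"]] by (simp add: a'_def)
  with close show ?thesis
    by (intro exI[of _ "?s' + (ramanujan_R a b - ramanujan_R a' b)"]) simp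
qed

text \<open>As \<open>-log (1 - x) = \<Sum> x\<^sup>n\<^sup>+\<^sup>1/(n + 1)\<close>, this is Ramanujan's asymptotic formula
  \<open>B(a,b) F(a,b;a+b;x) = R(a,b) - log (1 - x) + o(1)\<close> at \<open>x = 1\<close>, read off from the coefficients.\<close>

theorem beta_coeff_sums:
  assumes "a > 0" "b > 0"
  shows "(\<lambda>n. beta_coeff a b n - 1 / (1 + real n)) sums ramanujan_R a b"
proof -
  obtain s where s: "(\<lambda>n. beta_coeff a b n - 1 / (1 + real n)) sums s"
    using beta_coeff_sums_approx[OF assms] by blast
  have "\<bar>s - ramanujan_R a b\<bar> \<le> inverse (real (Suc N))" for N
    using beta_coeff_sums_approx[OF assms, of N] sums_unique2[OF s]
    by (auto simp: inverse_eq_divide)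
  then have "\<bar>s - ramanujan_R a b\<bar> \<le> 0"
    by (intro LIMSEQ_le_const[OF LIMSEQ_inverse_real_of_nat]) auto
  with s show ?thesis by simp
qed

text \<open>Subtracting two instances of the previous theorem cancels the harmonic series, so the nonnegative
  coefficients of \<open>K\<close> sum to the difference of the two constants.\<close>

lemma beta_gauss_F_diff_bounds:
  assumes "a > 0" "b > 0" "a' > 0" "b' > 0" "zb_le a b a' b'" "0 \<le> y" "y \<le> z" "z < 1"
  defines "K \<equiv> \<lambda>x. Beta a b * gauss_F a b (a + b) x - Beta a' b' * gauss_F a' b' (a' + b') x"
  shows "0 \<le> K y" "K y \<le> K z" "K z \<le> ramanujan_R a b - ramanujan_R a' b'"
proof -
  define k where "k n = beta_coeff a b n - beta_coeff a' b' n" for n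
  have k: "k n \<ge> 0" for n
    using beta_coeff_ge[OF assms(1-5)] by (simp add: k_def)
  have K: "(\<lambda>n. k n * x ^ n) sums K x" if "0 \<le> x" "x < 1" for x
    using sums_diff[OF beta_gauss_F_sums[of x a b] beta_gauss_F_sums[of x a' b']] that
    by (simp add: k_def K_def algebra_simps)
  have one: "k sums (ramanujan_R a b - ramanujan_R a' b')"
    using sums_diff[OF beta_coeff_sums[of a b] beta_coeff_sums[of a' b']] assms
    by (simp add: k_def[abs_def])
  show "0 \<le> K y"
    using assms k by (intro sums_le[OF _ sums_zero K]) auto
  show "K y \<le> K z"
    using assms k by (intro sums_le[OF _ K K]) (auto intro!: mult_left_mono power_mono)
  have "k n * z ^ n \<le> k n" for n
    using k[of n] assms by (intro mult_right_le_one_le) (auto intro!: power_le_one)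
  then show "K z \<le> ramanujan_R a b - ramanujan_R a' b'"
    using assms by (intro sums_le[OF _ K one]) auto
qed

section \<open>The cubic pair\<close>

lemma Beta_third: "Beta (1/3) (2/3) = 2 * pi / sqrt (3::real)"
proof -
  have "complex_of_real (Gamma (1/3) * Gamma (2/3)) = Gamma (1/3) * Gamma (1 - 1/3)"
    using Gamma_complex_of_real[of "1/3"] Gamma_complex_of_real[of "2/3"] by simp
  also have "\<dots> = of_real pi / sin (of_real pi * (1/3))"
    by (rule Gamma_reflection_complex)
  also have "\<dots> = complex_of_real (pi / sin (pi / 3))"
    using sin_of_real[of "pi / 3", where 'a = complex] by simp
  finally have "Gamma (1/3) * Gamma (2/3) = pi / sin (pi / 3)"
    by (simp only: of_real_eq_iff)
  then show ?thesis by (simp add: Beta_def sin_60)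
qed

text \<open>The terms \<open>1/(n + 1/3)\<close>, \<open>1/(n + 2/3)\<close> and \<open>1/(n + 1)\<close> for \<open>n < m\<close> are together three times the
  first \<open>3m\<close> terms of the harmonic series. This is the multiplication formula of Gauss
  for the digamma function, whose constant \<open>3 log 3 = log 27\<close> comes from \<open>log (3m) - log m\<close>.\<close>

lemma Digamma_thirds: "Digamma (1/3) + Digamma (2/3) = - 2 * euler_mascheroni - ln (27::real)"
proof -
  define h where "h m = ln (real m) - (\<Sum>n<m. inverse (1 + real n))" for m
  have h: "h \<longlonglongrightarrow> Digamma 1"
    using Digamma_LIMSEQ[of "1::real"] by (simp add: h_def[abs_def])
  have third: "(\<Sum>n<m. inverse (1/3 + real n)) + (\<Sum>n<m. inverse (2/3 + real n))
                + (\<Sum>n<m. inverse (1 + real n)) = 3 * (\<Sum>n<3*m. inverse (1 + real n))" for m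
  proof (induction m)
    case (Suc m)
    have "inverse (1/3 + real m) = 3 * inverse (1 + real (3 * m))"
         "inverse (2/3 + real m) = 3 * inverse (1 + real (3 * m + 1))"
         "inverse (1 + real m) = 3 * inverse (1 + real (3 * m + 2))"
      by (simp_all add: divide_simps add_eq_0_iff)
    moreover have "(\<Sum>n<3 * Suc m. inverse (1 + real n)) = (\<Sum>n<3*m. inverse (1 + real n))
        + inverse (1 + real (3 * m)) + inverse (1 + real (3 * m + 1)) + inverse (1 + real (3 * m + 2))"
      by (simp add: numeral_3_eq_3)
    ultimately show ?case
      using Suc.IH unfolding sum.lessThan_Suc by linarith
  qed simp
  have lim1: "(\<lambda>m. (of_real (ln (real m)) - (\<Sum>n<m. inverse (1/3 + of_nat n)))
            + (of_real (ln (real m)) - (\<Sum>n<m. inverse (2/3 + of_nat n)))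
            + (of_real (ln (real m)) - (\<Sum>n<m. inverse (1 + of_nat n))))
        \<longlonglongrightarrow> Digamma (1/3) + Digamma (2/3) + Digamma (1::real)"
    by (intro tendsto_add Digamma_LIMSEQ) auto
  have lim2: "(\<lambda>m. 3 * h (3 * m) - 3 * ln 3) \<longlonglongrightarrow> 3 * Digamma 1 - 3 * ln 3"
    by (intro tendsto_intros filterlim_compose[OF h] mult_nat_left_at_top) auto
  have "eventually (\<lambda>m. 3 * h (3 * m) - 3 * ln 3 =
        (of_real (ln (real m)) - (\<Sum>n<m. inverse (1/3 + of_nat n)))
            + (of_real (ln (real m)) - (\<Sum>n<m. inverse (2/3 + of_nat n)))
            + (of_real (ln (real m)) - (\<Sum>n<m. inverse (1 + of_nat n)))) sequentially"
    using eventually_gt_at_top[of 0]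
  proof eventually_elim
    case (elim m)
    have "3 * h (3 * m) = 3 * ln 3 + 3 * ln (real m) - 3 * (\<Sum>n<3*m. inverse (1 + real n))"
      using elim by (simp add: h_def ln_mult)
    then show ?case
      unfolding third[symmetric] by simp
  qed
  from LIMSEQ_unique[OF Lim_transform_eventually[OF lim2 this] lim1]
  have "3 * Digamma 1 - 3 * ln 3 = Digamma (1/3) + Digamma (2/3) + Digamma (1::real)" .
  moreover have "ln 27 = 3 * ln (3::real)"
    using ln_realpow[of 3 3] by simp
  ultimately show ?thesis by simp
qed

lemma ramanujan_R_third: "ramanujan_R (1/3) (2/3) = ln 27"
  using Digamma_thirds by (simp add: ramanujan_R_def)

section \<open>The cubic transformation\<close>

text \<open>For \<open>a + b = 1\<close> the hypergeometric equation takes the self-adjoint form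
  \<open>(t (1 - t) f')' = a b f\<close>. It is stated as the derivative of a product because
  the weighted Wronskian below contains \<open>f'\<close> only in the combination \<open>t (1 - t) f'(t)\<close>.\<close>

lemma gauss_F_balanced_ODE:
  assumes ab: "a + b = 1"
  obtains f' where
    "\<And>t. \<bar>t\<bar> < 1 \<Longrightarrow> (gauss_F a b 1 has_real_derivative f' t) (at t)"
    "\<And>t. \<bar>t\<bar> < 1 \<Longrightarrow>
       ((\<lambda>t. t * (1 - t) * f' t) has_real_derivative a * b * gauss_F a b 1 t) (at t)"
proof
  define H where "H = Abs_fps (zb_coeff a b)"
  define G where "G = fps_X * ((1 - fps_X) * fps_deriv H)"
  have conv: "fps_conv_radius H \<ge> 1"
    unfolding fps_conv_radius_def H_def
  proof (rule conv_radius_geI_ex')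
    fix r :: real assume "0 < r" "ereal r < 1"
    then show "summable (\<lambda>n. fps_nth (Abs_fps (zb_coeff a b)) n * of_real r ^ n)"
      using sums_summable[OF gauss_F_zb_sums[of r a b]] by simp
  qed
  have conv': "fps_conv_radius (fps_deriv H) \<ge> 1"
    using conv fps_conv_radius_deriv[of H] by (rule order_trans)
  have conv0: "fps_conv_radius (1 - fps_X :: real fps) \<ge> 1"
    by (intro order_trans[OF _ fps_conv_radius_diff]) simp
  have conv1: "fps_conv_radius ((1 - fps_X) * fps_deriv H) \<ge> 1"
    using conv' conv0 by (intro order_trans[OF _ fps_conv_radius_mult]) simp
  have convG: "fps_conv_radius G \<ge> 1"
    unfolding G_def using conv1 by (intro order_trans[OF _ fps_conv_radius_mult]) auto
  have inside: "ereal (norm t) < R" if "\<bar>t\<bar> < 1" "R \<ge> 1" for t :: real and R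
    by (rule less_le_trans[OF _ that(2)]) (use that(1) in simp)
  have F: "eval_fps H t = gauss_F a b 1 t" if "\<bar>t\<bar> < 1" for t
    using gauss_F_zb_sums[OF that, of a b] by (simp add: eval_fps_def H_def sums_iff ab)
  have near: "eventually (\<lambda>x. \<bar>x\<bar> < 1) (nhds t)" if "\<bar>t\<bar> < 1" for t :: real
    using that by (intro eventually_nhds_in_open[of "{x. \<bar>x\<bar> < 1}", simplified] open_Collect_less
        continuous_intros) auto
  show "(gauss_F a b 1 has_real_derivative eval_fps (fps_deriv H) t) (at t)" if "\<bar>t\<bar> < 1" for t
  proof -
    have "(eval_fps H has_real_derivative eval_fps (fps_deriv H) t) (at t)"
      using inside[OF that conv] by (rule has_field_derivative_eval_fps)
    then show ?thesis
      by (rule DERIV_cong_ev[THEN iffD1, OF refl _ refl, rotated])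
         (use near[OF that] in eventually_elim, simp add: F)
  qed
  have G_eval: "eval_fps G t = t * (1 - t) * eval_fps (fps_deriv H) t" if "\<bar>t\<bar> < 1" for t
    unfolding G_def using inside[OF that conv'] inside[OF that conv1] inside[OF that conv0]
    by (simp add: eval_fps_mult eval_fps_diff mult_ac)
  have "fps_deriv G = fps_const (a * b) * H"
  proof (rule fps_ext)
    fix n
    have b: "b = 1 - a" using ab by simp
    have H: "(1 + real n) * (1 + real n) * fps_nth H (Suc n) = (a + real n) * (b + real n) * fps_nth H n"
      by (simp add: H_def zb_coeff_Suc ab add_eq_0_iff)
    have "fps_nth (fps_deriv G) n = (1 + real n) * fps_nth ((1 - fps_X) * fps_deriv H) n"
      unfolding fps_deriv_nth by (simp add: G_def add.commute)
    also have "fps_nth ((1 - fps_X) * fps_deriv H) n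
       = (1 + real n) * fps_nth H (Suc n) - real n * fps_nth H n"
      by (simp add: left_diff_distrib)
    also have "(1 + real n) * \<dots>
        = (1 + real n) * (1 + real n) * fps_nth H (Suc n) - real n * (1 + real n) * fps_nth H n"
      by (simp add: algebra_simps)
    also have "\<dots> = ((a + real n) * (b + real n) - real n * (1 + real n)) * fps_nth H n"
      unfolding H by (simp add: algebra_simps)
    also have "(a + real n) * (b + real n) - real n * (1 + real n) = a * b"
      by (simp add: b algebra_simps)
    finally show "fps_nth (fps_deriv G) n = fps_nth (fps_const (a * b) * H) n"
      by simp
  qed
  then have G_deriv: "eval_fps (fps_deriv G) t = a * b * gauss_F a b 1 t" if "\<bar>t\<bar> < 1" for t
    using inside[OF that conv] F[OF that] by (simp add: eval_fps_mult)
  show "((\<lambda>t. t * (1 - t) * eval_fps (fps_deriv H) t) has_real_derivative a * b * gauss_F a b 1 t) (at t)"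
    if "\<bar>t\<bar> < 1" for t
  proof -
    have "(eval_fps G has_real_derivative a * b * gauss_F a b 1 t) (at t)"
      using has_field_derivative_eval_fps[OF inside[OF that convG]] G_deriv[OF that] by simp
    then show ?thesis
      by (rule DERIV_cong_ev[THEN iffD1, OF refl _ refl, rotated])
         (use near[OF that] in eventually_elim, simp add: G_eval)
  qed
qed

lemma gauss_F_at_0 [simp]: "gauss_F a b c 0 = 1"
  by (simp add: gauss_F_eval_fps eval_fps_at_0 fps_hypergeo_nth_alt)

lemma cubic_modulus_bounds:
  fixes x :: real
  assumes "0 \<le> x" "x < 1"
  shows "0 < ((1 - x) / (1 + 2 * x)) ^ 3" "((1 - x) / (1 + 2 * x)) ^ 3 \<le> 1"
  using assms by (auto intro!: power_le_one)

text \<open>Let \<open>f = F(1/3,2/3;1;\<cdot>)\<close>, let \<open>\<phi>\<close> be the argument on the left, and put \<open>P(x) = x (1 - x\<^sup>3)\<close>.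
  Since \<open>\<phi> (1 - \<phi>) = P \<phi>' / (1 + 2x)\<^sup>2\<close>, the equation for \<open>f\<close> turns into
  \<open>(P/(1 + 2x)\<^sup>2 u')' = 2/9 \<phi>' u\<close> for \<open>u = f \<circ> \<phi>\<close>, and \<open>v = (1 + 2x) f(x\<^sup>3)\<close> satisfies the
  same equation. In the proof, \<open>G(\<phi>)\<close> and \<open>V\<close> are \<open>P/(1 + 2x)\<^sup>2 u'\<close> and
  \<open>P/(1 + 2x)\<^sup>2 v'\<close>, written so that they can be differentiated with the equation for \<open>f\<close>,
  and \<open>w = u V - v G(\<phi>)\<close> is the weighted Wronskian. It is constant on \<open>[0,1)\<close>, and \<open>P\<close> vanishes
  at \<open>0\<close>, so \<open>w = 0\<close>. Hence \<open>u/v\<close> is constant, equal to its value \<open>1\<close> at \<open>0\<close>.\<close>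

lemma gauss_F_cubic:
  fixes x :: real
  assumes x: "0 \<le> x" "x < 1"
  shows "gauss_F (1/3) (2/3) 1 (1 - ((1 - x) / (1 + 2 * x)) ^ 3)
           = (1 + 2 * x) * gauss_F (1/3) (2/3) 1 (x ^ 3)"
proof (cases "x = 0")
  case False
  define f where "f = gauss_F (1/3) (2/3) 1"
  obtain f' where f': "\<And>t. \<bar>t\<bar> < 1 \<Longrightarrow> (f has_real_derivative f' t) (at t)"
    and ode: "\<And>t. \<bar>t\<bar> < 1 \<Longrightarrow> ((\<lambda>t. t * (1 - t) * f' t) has_real_derivative 2 / 9 * f t) (at t)"
    unfolding f_def by (rule gauss_F_balanced_ODE[of "1/3" "2/3"]) auto
  define G where "G = (\<lambda>t. t * (1 - t) * f' t)"
  define \<phi> where "\<phi> = (\<lambda>x::real. 1 - ((1 - x) / (1 + 2 * x)) ^ 3)"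
  define \<phi>' where "\<phi>' = (\<lambda>x::real. 9 * (1 - x)\<^sup>2 / (1 + 2 * x) ^ 4)"
  define P where "P = (\<lambda>x::real. x * (1 - x ^ 3))"
  define v where "v = (\<lambda>x. (1 + 2 * x) * f (x ^ 3))"
  define v' where "v' = (\<lambda>x. 2 * f (x ^ 3) + (1 + 2 * x) * (f' (x ^ 3) * (3 * x\<^sup>2)))"
  define V where "V = (\<lambda>x. 3 * G (x ^ 3) / (1 + 2 * x) + 2 * P x * f (x ^ 3) / (1 + 2 * x)\<^sup>2)"
  define w where "w = (\<lambda>x. f (\<phi> x) * V x - G (\<phi> x) * v x)"
  have bnd: "\<bar>t ^ 3\<bar> < 1" "\<bar>\<phi> t\<bar> < 1" if "0 \<le> t" "t < 1" for t
    using that cubic_modulus_bounds[OF that] by (auto simp: \<phi>_def power_less_one_iff)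
  have d\<phi>: "(\<phi> has_real_derivative \<phi>' t) (at t)" if "0 \<le> t" "t < 1" for t
  proof -
    have "((\<lambda>x. (1 - x) / (1 + 2 * x)) has_real_derivative
            ((-1) * (1 + 2 * t) - (1 - t) * 2) / ((1 + 2 * t) * (1 + 2 * t))) (at t)"
      using that by (intro DERIV_divide) (auto intro!: derivative_eq_intros)
    from DERIV_diff[OF DERIV_const[of 1] DERIV_power[OF this, of 3]]
    have "(\<phi> has_real_derivative
        0 - 3 * (((1 - t) / (1 + 2 * t))\<^sup>2
          * (((-1) * (1 + 2 * t) - (1 - t) * 2) / ((1 + 2 * t) * (1 + 2 * t))))) (at t)"
      unfolding \<phi>_def by (simp add: mult_ac)
    also have "((-1) * (1 + 2 * t) - (1 - t) * 2) = -3" by simp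
    also have "0 - 3 * (((1 - t) / (1 + 2 * t))\<^sup>2 * (-3 / ((1 + 2 * t) * (1 + 2 * t)))) = \<phi>' t"
      by (simp add: \<phi>'_def power2_eq_square power4_eq_xxxx)
    finally show ?thesis .
  qed
  have du: "((\<lambda>t. f (\<phi> t)) has_real_derivative f' (\<phi> t) * \<phi>' t) (at t)" if "0 \<le> t" "t < 1" for t
    using DERIV_chain2[OF f'[OF bnd(2)[OF that]] d\<phi>[OF that]] .
  have dGu: "((\<lambda>t. G (\<phi> t)) has_real_derivative 2 / 9 * f (\<phi> t) * \<phi>' t) (at t)"
    if "0 \<le> t" "t < 1" for t
    using DERIV_chain2[OF ode[OF bnd(2)[OF that]] d\<phi>[OF that]] by (simp add: G_def)
  have d3: "((\<lambda>t. t ^ 3) has_real_derivative 3 * t\<^sup>2) (at t)" for t :: real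
    by (auto intro!: derivative_eq_intros)
  have dg: "((\<lambda>t. f (t ^ 3)) has_real_derivative f' (t ^ 3) * (3 * t\<^sup>2)) (at t)"
    if "0 \<le> t" "t < 1" for t
    using DERIV_chain2[OF f'[OF bnd(1)[OF that]] d3] .
  have dGg: "((\<lambda>t. G (t ^ 3)) has_real_derivative 2 / 9 * f (t ^ 3) * (3 * t\<^sup>2)) (at t)"
    if "0 \<le> t" "t < 1" for t
    using DERIV_chain2[OF ode[OF bnd(1)[OF that]] d3] by (simp add: G_def)
  have dv: "(v has_real_derivative v' t) (at t)" if "0 \<le> t" "t < 1" for t
    unfolding v_def v'_def by (auto intro!: derivative_eq_intros dg[OF that])
  have Vv: "V t = P t / (1 + 2 * t)\<^sup>2 * v' t" if "0 \<le> t" for t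
    using that unfolding V_def v'_def P_def G_def
    by (simp add: divide_simps) (simp add: algebra_simps power2_eq_square power3_eq_cube)
  have Gu: "G (\<phi> t) = P t / (1 + 2 * t)\<^sup>2 * \<phi>' t * f' (\<phi> t)" if "0 \<le> t" for t
  proof -
    have "\<phi> t * (1 - \<phi> t) = P t / (1 + 2 * t)\<^sup>2 * \<phi>' t"
      using that unfolding \<phi>_def P_def \<phi>'_def
      by (simp add: divide_simps power_divide) (simp add: algebra_simps power2_eq_square power3_eq_cube power4_eq_xxxx)
    then show ?thesis by (simp add: G_def)
  qed
  have dV: "(V has_real_derivative 2 / 9 * \<phi>' t * v t) (at t)" if "0 \<le> t" "t < 1" for t
  proof -
    define g g' h where "g = f (t ^ 3)" and "g' = f' (t ^ 3)" and "h = 1 + 2 * t"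
    have "h > 0" using that by (simp add: h_def)
    have dP: "(P has_real_derivative 1 - 4 * t ^ 3) (at t)"
      unfolding P_def by (auto intro!: derivative_eq_intros simp: power3_eq_cube power2_eq_square)
    have D: "(V has_real_derivative
            (2 * g * t\<^sup>2 * h - 6 * G (t ^ 3)) / h\<^sup>2
          + ((2 * (1 - 4 * t ^ 3) * g + 2 * P t * (g' * (3 * t\<^sup>2))) * h\<^sup>2 - 2 * P t * g * (4 * h)) / h ^ 4) (at t)"
      unfolding V_def using that
      by (auto intro!: derivative_eq_intros dGg[OF that] dg[OF that] dP simp: g_def g'_def h_def power2_eq_square power4_eq_xxxx mult_ac)
    have "(2 * g * t\<^sup>2 * h - 6 * G (t ^ 3)) / h\<^sup>2
          + ((2 * (1 - 4 * t ^ 3) * g + 2 * P t * (g' * (3 * t\<^sup>2))) * h\<^sup>2 - 2 * P t * g * (4 * h)) / h ^ 4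
        = 2 * g * (t\<^sup>2 * h\<^sup>2 + (1 - 4 * t ^ 3) * h - 4 * P t) / h ^ 3"
      using \<open>h > 0\<close> by (simp add: G_def P_def g'_def divide_simps)
         (simp add: algebra_simps eval_nat_numeral)
    also have "t\<^sup>2 * h\<^sup>2 + (1 - 4 * t ^ 3) * h - 4 * P t = (1 - t)\<^sup>2"
      by (simp add: h_def P_def algebra_simps power2_eq_square power3_eq_cube)
    \<comment> \<open>The derivatives of \<open>f(t\<^sup>3)\<close> have cancelled and left the right-hand side of the equation for \<open>u\<close>, with \<open>v\<close> in its place.\<close>
    also have "2 * g * (1 - t)\<^sup>2 / h ^ 3 = 2 / 9 * \<phi>' t * v t"
    proof -
      have "\<phi>' t = 9 * (1 - t)\<^sup>2 / h ^ 4" "v t = h * g"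
        by (simp_all add: \<phi>'_def v_def g_def h_def)
      then show ?thesis
        using \<open>h > 0\<close> by (simp add: power4_eq_xxxx power3_eq_cube mult_ac)
    qed
    finally show ?thesis using D by (simp only:)
  qed
  have w_const: "w t = 0" if t: "0 < t" "t < 1" for t
  proof -
    have dw: "(w has_real_derivative 0) (at s)" if "0 \<le> s" "s < 1" for s
    proof -
      have "(w has_real_derivative
              (f' (\<phi> s) * \<phi>' s) * V s + (2 / 9 * \<phi>' s * v s) * f (\<phi> s)
              - ((2 / 9 * f (\<phi> s) * \<phi>' s) * v s + v' s * G (\<phi> s))) (at s)"
        unfolding w_def by (intro DERIV_diff DERIV_mult du dV dGu dv that)
      then show ?thesis
        using that by (simp add: Vv Gu algebra_simps)
    qed
    have "w t = w 0"
    proof (rule DERIV_isconst_end[where f = w])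
      show "continuous_on {0..t} w"
        using t by (auto intro!: continuous_at_imp_continuous_on DERIV_isCont[OF dw])
    qed (use dw t in auto)
    also have "w 0 = 0"
      by (simp add: w_def V_def P_def G_def \<phi>_def)
    finally show ?thesis .
  qed
  have v_pos: "v t > 0" if "0 \<le> t" "t < 1" for t
    using gauss_F_zb_pos[of "1/3" "2/3" "t ^ 3"] that
    by (simp add: v_def f_def power_less_one_iff)
  define q where "q = (\<lambda>t. f (\<phi> t) / v t)"
  have dq: "(q has_real_derivative
      (f' (\<phi> t) * \<phi>' t * v t - f (\<phi> t) * v' t) / (v t * v t)) (at t)" if "0 \<le> t" "t < 1" for t
    unfolding q_def using v_pos[OF that] by (intro DERIV_divide du dv that) auto
  have "q x = q 0"
  proof (rule DERIV_isconst_end[where f = q])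
    show "continuous_on {0..x} q"
      using x by (auto intro!: continuous_at_imp_continuous_on DERIV_isCont[OF dq])
    fix t assume t: "0 < t" "t < x"
    have "P t > 0"
      using t x by (auto simp: P_def power_less_one_iff)
    have "P t / (1 + 2 * t)\<^sup>2 * (f' (\<phi> t) * \<phi>' t * v t - f (\<phi> t) * v' t) = - w t"
      using t by (simp add: w_def Vv Gu algebra_simps)
    also have "\<dots> = 0" using w_const[of t] t x by simp
    finally have "f' (\<phi> t) * \<phi>' t * v t - f (\<phi> t) * v' t = 0"
      using \<open>P t > 0\<close> t by simp
    with dq[of t] t x show "(q has_real_derivative 0) (at t)" by simp
  qed (use x False in auto)
  moreover have "q 0 = 1"
    by (simp add: q_def v_def \<phi>_def f_def)
  ultimately show ?thesis
    using v_pos[OF x] by (simp add: q_def f_def v_def \<phi>_def)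
qed simp

text \<open>The map \<open>x \<mapsto> (1 - x)/(1 + 2x)\<close> is an involution, and applying the transformation at the image of
  \<open>x\<close> exchanges the two arguments with their complements.\<close>

lemma gauss_F_cubic_complementary:
  fixes x :: real
  assumes x: "0 < x" "x < 1"
  shows "3 * gauss_F (1/3) (2/3) 1 (((1 - x) / (1 + 2 * x)) ^ 3)
           = (1 + 2 * x) * gauss_F (1/3) (2/3) 1 (1 - x ^ 3)"
proof -
  define s where "s = (1 - x) / (1 + 2 * x)"
  have s: "0 \<le> s" "s < 1" using x by (auto simp: s_def)
  have s1: "1 + 2 * s = 3 / (1 + 2 * x)" and s2: "1 - s = 3 * x / (1 + 2 * x)"
    using x by (auto simp: s_def field_simps)
  have "(1 - s) / (1 + 2 * s) = x"
    unfolding s1 s2 using x by simp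
  with gauss_F_cubic[OF s]
  have "gauss_F (1/3) (2/3) 1 (1 - x ^ 3) = 3 / (1 + 2 * x) * gauss_F (1/3) (2/3) 1 (s ^ 3)"
    unfolding s1 by simp
  then have "(1 + 2 * x) * gauss_F (1/3) (2/3) 1 (1 - x ^ 3) = 3 * gauss_F (1/3) (2/3) 1 (s ^ 3)"
    using x by simp
  then show ?thesis by (simp only: s_def)
qed

section \<open>The inequalities\<close>

lemma cubic_arguments:
  fixes x :: real
  assumes x: "0 < x" "x < 1"
  shows "0 < ((1 - x) / (1 + 2 * x)) ^ 3" "((1 - x) / (1 + 2 * x)) ^ 3 \<le> 1 - x ^ 3"
        "1 - x ^ 3 < 1"
proof -
  define s where "s = (1 - x) / (1 + 2 * x)"
  have s: "0 < s" "s \<le> 1 - x" using x by (auto simp: s_def divide_simps mult_less_0_iff)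
  have "s ^ 3 \<le> s ^ 1" using s x by (intro power_decreasing) auto
  moreover have "x ^ 3 \<le> x ^ 1" using x by (intro power_decreasing) auto
  ultimately have "s ^ 3 \<le> 1 - x ^ 3" using s by simp
  then show "((1 - x) / (1 + 2 * x)) ^ 3 \<le> 1 - x ^ 3" by (simp only: s_def)
  show "0 < ((1 - x) / (1 + 2 * x)) ^ 3" "1 - x ^ 3 < 1"
    using x by auto
qed

lemma Beta_third_quotient: "B / Beta (1/3) (2/3) / 3 = sqrt 3 * B / (6 * pi)"
  by (simp add: Beta_third)

text \<open>Used with \<open>p\<close>, \<open>q\<close> the values of the difference \<open>K\<close> at \<open>y\<close> and \<open>z\<close>, \<open>r\<close> their common bound,
  and \<open>h = 1 + 2x\<close>.\<close>

lemma difference_step: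
  fixes h :: real
  assumes "0 \<le> p" "p \<le> q" "q \<le> r" "1 \<le> h"
  shows "3 * p \<le> h * (q + 2 * r)"
proof -
  have "3 * p \<le> 1 * (q + 2 * r)" using assms by simp
  also have "\<dots> \<le> h * (q + 2 * r)" using assms by (intro mult_right_mono) auto
  finally show ?thesis .
qed

text \<open>The cubic transformation replaces \<open>3 F\<^sub>0(y)\<close> by \<open>(1 + 2x) F\<^sub>0(z)\<close> in each of the three
  comparisons of \<open>F\<close> with \<open>F\<^sub>0\<close>.\<close>

lemma cubic_bounds_lower_coeffs:
  fixes a b x :: real
  assumes ab: "a > 0" "b > 0" and le: "zb_le a b (1/3) (2/3)" and x: "0 < x" "x < 1"
  defines "F \<equiv> gauss_F a b (a + b)" and "y \<equiv> ((1 - x) / (1 + 2 * x)) ^ 3" and "z \<equiv> 1 - x ^ 3"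
  shows "(1 + 2 * x) * F z \<le> 3 * F y"
    and "F y \<le> sqrt 3 * Beta a b / (6 * pi) * ((1 + 2 * x) * F z)"
    and "3 * F y \<le> (1 + 2 * x) * (F z + 2 * (ramanujan_R a b - ln 27) / Beta a b)"
proof -
  define F0 where "F0 = gauss_F (1/3) (2/3) 1"
  define B B0 where "B = Beta a b" and "B0 = Beta (1/3) (2/3 :: real)"
  have B: "B > 0" "B0 > 0" using ab by (auto simp: B_def B0_def intro!: Beta_pos)
  have yz: "0 < y" "y \<le> z" "z < 1"
    unfolding y_def z_def using cubic_arguments[OF x] by auto
  have cubic: "3 * F0 y = (1 + 2 * x) * F0 z"
    unfolding F0_def y_def z_def by (rule gauss_F_cubic_complementary[OF x])
  have pos: "F0 z > 0"
    using gauss_F_zb_pos[of "1/3" "2/3" z] yz by (simp add: F0_def)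
  have "F z * F0 y \<le> F y * F0 z"
    using gauss_F_zb_ratio_antimono[OF ab _ _ le yz] by (simp add: F_def F0_def)
  then have "F z * (3 * F0 y) \<le> 3 * F y * F0 z" by simp
  then have "((1 + 2 * x) * F z) * F0 z \<le> (3 * F y) * F0 z" unfolding cubic by (simp add: mult_ac)
  then show "(1 + 2 * x) * F z \<le> 3 * F y"
    using pos by (rule mult_right_le_imp_le)
  have "F y \<le> F0 y"
    using gauss_F_zb_le[OF ab _ _ le, of y] yz by (simp add: F_def F0_def)
  also have "\<dots> = (1 + 2 * x) * F0 z / 3" using cubic by simp
  also have "F0 z \<le> B / B0 * F z"
    using beta_gauss_F_ge[OF ab _ _ le, of z] yz B
    by (simp add: F_def F0_def B_def B0_def field_simps)
  also have "(1 + 2 * x) * (B / B0 * F z) / 3 = B / B0 / 3 * ((1 + 2 * x) * F z)" by simp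
  also have "B / B0 / 3 = sqrt 3 * Beta a b / (6 * pi)"
    unfolding B0_def B_def by (rule Beta_third_quotient)
  finally show "F y \<le> sqrt 3 * Beta a b / (6 * pi) * ((1 + 2 * x) * F z)"
    using x by (simp add: divide_right_mono mult_left_mono)
  define K where "K t = B * F t - B0 * F0 t" for t
  have K: "0 \<le> K y" "K y \<le> K z" "K z \<le> ramanujan_R a b - ln 27"
    using beta_gauss_F_diff_bounds[OF ab _ _ le, of y z] yz
    by (simp_all add: K_def F_def F0_def B_def B0_def ramanujan_R_third)
  have "3 * K y \<le> (1 + 2 * x) * (K z + 2 * (ramanujan_R a b - ln 27))"
    using K x by (intro difference_step) auto
  moreover have "B * (3 * F y) = 3 * K y + B0 * (3 * F0 y)"
    by (simp add: K_def algebra_simps)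
  ultimately have "B * (3 * F y) \<le> (1 + 2 * x) * (K z + 2 * (ramanujan_R a b - ln 27))
      + B0 * ((1 + 2 * x) * F0 z)"
    unfolding cubic by simp
  also have "\<dots> = B * ((1 + 2 * x) * (F z + 2 * (ramanujan_R a b - ln 27) / B))"
  proof -
    have "B * ((1 + 2 * x) * (F z + 2 * d / B)) = (1 + 2 * x) * (B * F z + 2 * d)" for d
      using B by (simp add: field_simps)
    from this[of "ramanujan_R a b - ln 27"] show ?thesis
      by (simp only:) (simp add: K_def algebra_simps)
  qed
  finally show "3 * F y \<le> (1 + 2 * x) * (F z + 2 * (ramanujan_R a b - ln 27) / Beta a b)"
    using B by (simp add: B_def)
qed

text \<open>The mirror image, where \<open>F\<^sub>0\<close> is the series with the smaller coefficients.\<close>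

lemma cubic_bounds_upper_coeffs:
  fixes a b x :: real
  assumes ab: "a > 0" "b > 0" and le: "zb_le (1/3) (2/3) a b" and x: "0 < x" "x < 1"
  defines "F \<equiv> gauss_F a b (a + b)" and "y \<equiv> ((1 - x) / (1 + 2 * x)) ^ 3" and "z \<equiv> 1 - x ^ 3"
  shows "3 * F y \<le> (1 + 2 * x) * F z"
    and "sqrt 3 * Beta a b / (6 * pi) * ((1 + 2 * x) * F z) \<le> F y"
    and "(1 + 2 * x) * F z - 3 * F y \<le> 2 * (1 + 2 * x) * (ln 27 - ramanujan_R a b) / Beta a b"
proof -
  define F0 where "F0 = gauss_F (1/3) (2/3) 1"
  define B B0 where "B = Beta a b" and "B0 = Beta (1/3) (2/3 :: real)"
  have B: "B > 0" "B0 > 0" using ab by (auto simp: B_def B0_def intro!: Beta_pos)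
  have yz: "0 < y" "y \<le> z" "z < 1"
    unfolding y_def z_def using cubic_arguments[OF x] by auto
  have cubic: "3 * F0 y = (1 + 2 * x) * F0 z"
    unfolding F0_def y_def z_def by (rule gauss_F_cubic_complementary[OF x])
  have pos: "F0 z > 0"
    using gauss_F_zb_pos[of "1/3" "2/3" z] yz by (simp add: F0_def)
  have "F0 z * F y \<le> F0 y * F z"
    using gauss_F_zb_ratio_antimono[OF _ _ ab le yz] by (simp add: F_def F0_def mult_ac)
  then have "(3 * F y) * F0 z \<le> (3 * F0 y) * F z" by (simp add: mult_ac)
  then have "(3 * F y) * F0 z \<le> ((1 + 2 * x) * F z) * F0 z" unfolding cubic by (simp add: mult_ac)
  then show "3 * F y \<le> (1 + 2 * x) * F z"
    using pos by (rule mult_right_le_imp_le)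
  have "sqrt 3 * Beta a b / (6 * pi) = B / B0 / 3"
    unfolding B0_def B_def by (rule Beta_third_quotient[symmetric])
  also have "B / B0 / 3 * ((1 + 2 * x) * F z) = (1 + 2 * x) * (B / B0 * F z) / 3" by simp
  also have "B / B0 * F z \<le> F0 z"
    using beta_gauss_F_ge[OF _ _ ab le, of z] yz B
    by (simp add: F_def F0_def B_def B0_def field_simps)
  also have "(1 + 2 * x) * F0 z / 3 = F0 y" using cubic by simp
  also have "F0 y \<le> F y"
    using gauss_F_zb_le[OF _ _ ab le, of y] yz by (simp add: F_def F0_def)
  finally show "sqrt 3 * Beta a b / (6 * pi) * ((1 + 2 * x) * F z) \<le> F y"
    using x by (simp add: divide_right_mono mult_left_mono)
  define K where "K t = B0 * F0 t - B * F t" for t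
  have K: "0 \<le> K y" "K y \<le> K z" "K z \<le> ln 27 - ramanujan_R a b"
    using beta_gauss_F_diff_bounds[OF _ _ ab le, of y z] yz
    by (simp_all add: K_def F_def F0_def B_def B0_def ramanujan_R_third)
  have "3 * K y \<le> (1 + 2 * x) * (K z + 2 * (ln 27 - ramanujan_R a b))"
    using K x by (intro difference_step) auto
  moreover have "B * ((1 + 2 * x) * F z - 3 * F y)
      = 3 * K y - (1 + 2 * x) * K z + B0 * ((1 + 2 * x) * F0 z - 3 * F0 y)"
    by (simp add: K_def algebra_simps)
  ultimately have "B * ((1 + 2 * x) * F z - 3 * F y) \<le> (1 + 2 * x) * (2 * (ln 27 - ramanujan_R a b))"
    unfolding cubic by (simp add: algebra_simps)
  then show "(1 + 2 * x) * F z - 3 * F y \<le> 2 * (1 + 2 * x) * (ln 27 - ramanujan_R a b) / Beta a b"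
    using B unfolding B_def by (simp only: pos_le_divide_eq) (simp only: mult_ac)
qed

lemma region_D5_subset_D1: "region_D5 \<subseteq> region_D1"
  by (auto simp: region_D5_def region_D1_def)

lemma region_D6_subset_D3: "region_D6 \<subseteq> region_D3"
  by (auto simp: region_D6_def region_D3_def)

lemma zb_le_region_D1: "(a, b) \<in> region_D1 \<Longrightarrow> zb_le a b (1/3) (2/3)"
  by (auto simp: region_D1_def zb_le_def)

lemma zb_le_region_D3: "(a, b) \<in> region_D3 \<Longrightarrow> zb_le (1/3) (2/3) a b"
  by (auto simp: region_D3_def zb_le_def)

theorem theorem2p5:
  fixes a b :: real
  assumes "a > 0" and "b > 0"
  shows
    "((a, b) \<in> region_D1 \<longrightarrow>
        (\<forall>x::real. 0 < x \<and> x < 1 \<longrightarrow>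
           1 / 3 \<le> gauss_F a b (a + b) (((1 - x) / (1 + 2 * x)) ^ 3)
                    / ((1 + 2 * x) * gauss_F a b (a + b) (1 - x ^ 3))
         \<and> gauss_F a b (a + b) (((1 - x) / (1 + 2 * x)) ^ 3)
             / ((1 + 2 * x) * gauss_F a b (a + b) (1 - x ^ 3))
           \<le> sqrt 3 * Beta a b / (6 * pi)))
   \<and> ((a, b) \<in> region_D3 \<longrightarrow>
        (\<forall>x::real. 0 < x \<and> x < 1 \<longrightarrow>
           sqrt 3 * Beta a b / (6 * pi)
             \<le> gauss_F a b (a + b) (((1 - x) / (1 + 2 * x)) ^ 3)
                / ((1 + 2 * x) * gauss_F a b (a + b) (1 - x ^ 3))
         \<and> gauss_F a b (a + b) (((1 - x) / (1 + 2 * x)) ^ 3)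
             / ((1 + 2 * x) * gauss_F a b (a + b) (1 - x ^ 3))
           \<le> 1 / 3))
   \<and> ((a, b) \<in> region_D5 \<longrightarrow>
        (\<forall>x::real. 0 < x \<and> x < 1 \<longrightarrow>
           (1 + 2 * x) * gauss_F a b (a + b) (1 - x ^ 3)
             \<le> 3 * gauss_F a b (a + b) (((1 - x) / (1 + 2 * x)) ^ 3)
         \<and> 3 * gauss_F a b (a + b) (((1 - x) / (1 + 2 * x)) ^ 3)
             \<le> (1 + 2 * x) * (gauss_F a b (a + b) (1 - x ^ 3)
                 + 2 * (ramanujan_R a b - ln 27) / Beta a b)))
   \<and> ((a, b) \<in> region_D6 \<longrightarrow>
        (\<forall>x::real. 0 < x \<and> x < 1 \<longrightarrow>
           0 \<le> (1 + 2 * x) * gauss_F a b (a + b) (1 - x ^ 3)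
                - 3 * gauss_F a b (a + b) (((1 - x) / (1 + 2 * x)) ^ 3)
         \<and> (1 + 2 * x) * gauss_F a b (a + b) (1 - x ^ 3)
             - 3 * gauss_F a b (a + b) (((1 - x) / (1 + 2 * x)) ^ 3)
             \<le> 2 * (1 + 2 * x) * (ln 27 - ramanujan_R a b) / Beta a b))"
proof -
  have denominator: "(1 + 2 * x) * gauss_F a b (a + b) (1 - x ^ 3) > 0" if "0 < x" "x < 1" for x :: real
    using that assms cubic_arguments[OF that] by (intro mult_pos_pos gauss_F_zb_pos) (auto intro: power_le_one)
  note lower = cubic_bounds_lower_coeffs[OF assms zb_le_region_D1]
  note upper = cubic_bounds_upper_coeffs[OF assms zb_le_region_D3]
  show ?thesis
  proof (intro conjI impI allI; (elim conjE)?)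
    fix x :: real
    assume x: "0 < x" "x < 1"
    note frac_le_iff = pos_divide_le_eq[OF denominator[OF x]] pos_le_divide_eq[OF denominator[OF x]]
    {
      assume "(a, b) \<in> region_D1"
      note bounds = lower[OF this x]
      show "1 / 3 \<le> gauss_F a b (a + b) (((1 - x) / (1 + 2 * x)) ^ 3)
              / ((1 + 2 * x) * gauss_F a b (a + b) (1 - x ^ 3))"
        unfolding frac_le_iff using bounds(1) by simp
      show "gauss_F a b (a + b) (((1 - x) / (1 + 2 * x)) ^ 3)
              / ((1 + 2 * x) * gauss_F a b (a + b) (1 - x ^ 3)) \<le> sqrt 3 * Beta a b / (6 * pi)"
        unfolding frac_le_iff by (rule bounds(2))
    next
      assume "(a, b) \<in> region_D3"
      note bounds = upper[OF this x]
      show "gauss_F a b (a + b) (((1 - x) / (1 + 2 * x)) ^ 3)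
              / ((1 + 2 * x) * gauss_F a b (a + b) (1 - x ^ 3)) \<le> 1 / 3"
        unfolding frac_le_iff using bounds(1) by simp
      show "sqrt 3 * Beta a b / (6 * pi) \<le> gauss_F a b (a + b) (((1 - x) / (1 + 2 * x)) ^ 3)
              / ((1 + 2 * x) * gauss_F a b (a + b) (1 - x ^ 3))"
        unfolding frac_le_iff by (rule bounds(2))
    next
      assume "(a, b) \<in> region_D5"
      then have "(a, b) \<in> region_D1" using region_D5_subset_D1 by blast
      note bounds = lower[OF this x]
      show "(1 + 2 * x) * gauss_F a b (a + b) (1 - x ^ 3)
              \<le> 3 * gauss_F a b (a + b) (((1 - x) / (1 + 2 * x)) ^ 3)"
        by (rule bounds(1))
      show "3 * gauss_F a b (a + b) (((1 - x) / (1 + 2 * x)) ^ 3)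
              \<le> (1 + 2 * x) * (gauss_F a b (a + b) (1 - x ^ 3)
                  + 2 * (ramanujan_R a b - ln 27) / Beta a b)"
        by (rule bounds(3))
    next
      assume "(a, b) \<in> region_D6"
      then have "(a, b) \<in> region_D3" using region_D6_subset_D3 by blast
      note bounds = upper[OF this x]
      show "0 \<le> (1 + 2 * x) * gauss_F a b (a + b) (1 - x ^ 3)
                - 3 * gauss_F a b (a + b) (((1 - x) / (1 + 2 * x)) ^ 3)"
        using bounds(1) by simp
      show "(1 + 2 * x) * gauss_F a b (a + b) (1 - x ^ 3)
              - 3 * gauss_F a b (a + b) (((1 - x) / (1 + 2 * x)) ^ 3)
             \<le> 2 * (1 + 2 * x) * (ln 27 - ramanujan_R a b) / Beta a b"
        by (rule bounds(3))
    }
  qed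
qed

end
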